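(* Let $X$ be a regular topological space that has a dense subset $E$ with $|E|\le 2^{\omega}$, and let $p\in X$ be a point such that Bob has a winning strategy in the game $\mathsf{G}_1^{\omega_1}(\Omega_p,\Omega_p)$. Then $\chi(p,X)\le 2^{\omega}$.
   Context: Convention (Engelking): regular spaces are $T_1$. $\chi(p,X)$ is the character of $p$ in $X$, i.e. the least infinite cardinal $\kappa$ such that $p$ has a local base in $X$ of cardinality at most $\kappa$. For $p\in X$, $\Omega_p$ denotes the collection of all sets $A\subseteq X$ with $p\in\overline{A}$. The game $\mathsf{G}_1^{\omega_1}(\Omega_p,\Omega_p)$ (long tightness game) is played by Alice and Bob with innings indexed by the ordinals $\xi<\omega_1$. At inning $\xi$ Alice chooses $A_\xi\in\Omega_p$, and then Bob chooses a point $a_\xi\in A_\xi$. Bob wins the play if $\{a_\xi:\xi<\omega_1\}\in\Omega_p$; otherwise Alice wins. A strategy for Bob is a function $\sigma$ assigning to each sequence $s=\langle A_\beta:\beta\le\alpha\rangle$ of elements of $\Omega_p$ with $\alpha<\omega_1$ (the moves of Alice up to and including inning $\alpha$) a point $\sigma(s)\in A_\alpha$. It is winning if Bob wins every play in which his move at each inning $\alpha<\omega_1$ is $\sigma(\langle A_\beta:\beta\le\alpha\rangle)$. *)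

theory Defs
  imports "HOL-Analysis.Analysis"
begin

unbundle cardinal_syntax

definition local_base :: "'a topology \<Rightarrow> 'a \<Rightarrow> 'a set set \<Rightarrow> bool" where
  "local_base X p \<B> \<longleftrightarrow>
     (\<forall>U\<in>\<B>. openin X U \<and> p \<in> U) \<and>
     (\<forall>V. openin X V \<and> p \<in> V \<longrightarrow> (\<exists>U\<in>\<B>. U \<subseteq> V))"

text \<open>The infinite cardinals \<open>\<kappa>\<close> for which \<open>p\<close> has a local base of size at most
  \<open>\<kappa>\<close>, as cardinal orders on subsets of an arbitrary type.\<close>

definition character_bound :: "'a topology \<Rightarrow> 'a \<Rightarrow> 'k rel \<Rightarrow> bool" where
  "character_bound X p \<kappa> \<longleftrightarrow> Cinfinite \<kappa> \<and> (\<exists>\<B>. local_base X p \<B> \<and> |\<B>| \<le>o \<kappa>)"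

text \<open>The character is the least such cardinal. The type \<open>'a set + nat\<close> is large enough
  to realise it: it has room for every local base and for an infinite set. That the
  minimum does not depend on this choice is the lemma \<open>character_least\<close> below.\<close>

definition character :: "'a topology \<Rightarrow> 'a \<Rightarrow> ('a set + nat) rel" where
  "character X p =
     (SOME \<kappa>. character_bound X p \<kappa> \<and>
        (\<forall>\<kappa>' :: ('a set + nat) rel. character_bound X p \<kappa>' \<longrightarrow> \<kappa> \<le>o \<kappa>'))"

lemma character_boundI:
  assumes "Cinfinite \<kappa>" and "local_base X p \<B>" and "|\<B>| \<le>o \<kappa>"
  shows "character_bound X p \<kappa>"
  using assms unfolding character_bound_def by blast

lemma character_bound_transfer:
  fixes X :: "'a topology" and \<kappa> :: "'k rel"
  assumes "character_bound X p \<kappa>"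
  shows "\<exists>\<mu> :: ('a set + nat) rel. character_bound X p \<mu> \<and> \<mu> \<le>o \<kappa>"
proof -
  obtain \<B> where \<B>: "local_base X p \<B>" "|\<B>| \<le>o \<kappa>"
    and inf: "\<not> finite (Field \<kappa>)" and co: "Card_order \<kappa>"
    using assms unfolding character_bound_def cinfinite_def by blast
  let ?\<mu> = "|\<B> <+> (UNIV :: nat set)|"
  have "|UNIV :: nat set| \<le>o |Field \<kappa>|"
    using inf infinite_iff_card_of_nat by blast
  then have "|UNIV :: nat set| \<le>o \<kappa>"
    using co card_of_Field_ordIso ordLeq_ordIso_trans by blast
  then have le: "?\<mu> \<le>o \<kappa>"
    by (rule card_of_Plus_ordLeq_infinite_Field[OF inf \<B>(2) _ co])
  have "Cinfinite ?\<mu>"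
    unfolding cinfinite_def Field_card_of using card_of_card_order_on by simp
  then have "character_bound X p ?\<mu>"
    by (rule character_boundI[OF _ \<B>(1) card_of_Plus1])
  with le show ?thesis
    by (intro exI[of _ ?\<mu>] conjI)
qed

lemma character_min:
  fixes X :: "'a topology"
  assumes "p \<in> topspace X"
  shows "character_bound X p (character X p) \<and>
    (\<forall>\<kappa>' :: ('a set + nat) rel. character_bound X p \<kappa>' \<longrightarrow> character X p \<le>o \<kappa>')"
proof -
  let ?R = "{\<kappa> :: ('a set + nat) rel. character_bound X p \<kappa>}"
  let ?U = "|UNIV :: ('a set + nat) set|"
  let ?N = "{U. openin X U \<and> p \<in> U}"
  have N: "local_base X p ?N"
    unfolding local_base_def by blast
  have "|?N| \<le>o ?U"
    by (rule card_of_ordLeqI[of Inl]) auto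
  moreover have "Cinfinite ?U"
    unfolding cinfinite_def Field_card_of using card_of_card_order_on by simp
  ultimately have "character_bound X p ?U"
    by (rule character_boundI[OF _ N, rotated])
  then have "?R \<noteq> {}"
    by blast
  moreover have "\<forall>\<kappa>\<in>?R. Card_order \<kappa>"
    unfolding character_bound_def by blast
  ultimately have "\<exists>\<kappa>\<in>?R. \<forall>\<kappa>'\<in>?R. \<kappa> \<le>o \<kappa>'"
    by (rule exists_minim_Card_order)
  then have "\<exists>\<kappa> :: ('a set + nat) rel. character_bound X p \<kappa> \<and>
      (\<forall>\<kappa>' :: ('a set + nat) rel. character_bound X p \<kappa>' \<longrightarrow> \<kappa> \<le>o \<kappa>')"
    by simp
  then show ?thesis
    unfolding character_def by (rule someI_ex)
qed

lemma character_least: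
  fixes X :: "'a topology" and \<kappa> :: "'k rel"
  assumes "p \<in> topspace X" and "character_bound X p \<kappa>"
  shows "character X p \<le>o \<kappa>"
proof -
  obtain \<mu> :: "('a set + nat) rel" where \<mu>: "character_bound X p \<mu>" "\<mu> \<le>o \<kappa>"
    using character_bound_transfer[OF assms(2)] by (elim exE conjE)
  have "character X p \<le>o \<mu>"
    using character_min[OF assms(1)] \<mu>(1) by simp
  then show ?thesis
    using \<mu>(2) by (rule ordLeq_transitive)
qed

definition Omega_at :: "'a topology \<Rightarrow> 'a \<Rightarrow> 'a set set" where
  "Omega_at X p = {A. A \<subseteq> topspace X \<and> p \<in> X closure_of A}"

text \<open>The ordinals below \<open>\<omega>\<^sub>1\<close> are the elements of the field of the well-order
  \<open>cardSuc natLeq\<close>; \<open>under omega1 \<alpha>\<close> is \<open>{\<beta>. \<beta> \<le> \<alpha>}\<close>.\<close>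

abbreviation omega1 :: "nat set rel" where
  "omega1 \<equiv> cardSuc natLeq"

text \<open>A sequence \<open>\<langle>A\<^sub>\<beta> : \<beta> \<le> \<alpha>\<rangle>\<close> is given by the pair of \<open>\<alpha>\<close> and the
  extensional function \<open>\<beta> \<mapsto> A\<^sub>\<beta>\<close> on \<open>under omega1 \<alpha>\<close>.\<close>

definition bob_strategy ::
    "'a topology \<Rightarrow> 'a \<Rightarrow> (nat set \<Rightarrow> (nat set \<Rightarrow> 'a set) \<Rightarrow> 'a) \<Rightarrow> bool" where
  "bob_strategy X p \<sigma> \<longleftrightarrow>
     (\<forall>\<alpha>\<in>Field omega1. \<forall>s \<in> under omega1 \<alpha> \<rightarrow>\<^sub>E Omega_at X p. \<sigma> \<alpha> s \<in> s \<alpha>)"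

definition bob_wins :: "'a topology \<Rightarrow> 'a \<Rightarrow> (nat set \<Rightarrow> 'a) \<Rightarrow> bool" where
  "bob_wins X p a \<longleftrightarrow> a ` Field omega1 \<in> Omega_at X p"

definition bob_winning_strategy ::
    "'a topology \<Rightarrow> 'a \<Rightarrow> (nat set \<Rightarrow> (nat set \<Rightarrow> 'a set) \<Rightarrow> 'a) \<Rightarrow> bool" where
  "bob_winning_strategy X p \<sigma> \<longleftrightarrow>
     bob_strategy X p \<sigma> \<and>
     (\<forall>A \<in> Field omega1 \<rightarrow> Omega_at X p.
        bob_wins X p (\<lambda>\<alpha>. \<sigma> \<alpha> (restrict A (under omega1 \<alpha>))))"

end

theory Submission
  imports Defs
begin

text \<open>
  After any history of Alice's moves, the points that Bob's strategy \<open>\<sigma>\<close> can be forced to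
  answer contain a neighbourhood of \<open>p\<close>: otherwise Alice could play the set of points that
  are never answered. Fix, for each history and each answer in \<open>E\<close>, one move of Alice that
  forces this answer. The histories made of such moves only are determined by countable
  sequences in \<open>E\<close>, so there are at most \<open>2\<^sup>\<omega>\<close> of them, and so many neighbourhoods. If none of
  these had its trace on \<open>E\<close> inside a given open set \<open>V\<close> containing \<open>p\<close>, Alice could force all answers
  to lie outside \<open>V\<close> and win. Hence some trace lies in \<open>V\<close>, and as \<open>E\<close> is dense
  the neighbourhood itself lies in the closure of \<open>V\<close>; regularity finishes the proof.
\<close>

section \<open>Cardinalities of countable sequences and of initial segments of
  \<open>omega1\<close>\<close>

lemma card_of_PiE_countable_le_continuum:
  assumes "countable A" and "|E| \<le>o |UNIV :: nat set set|"
  shows "|A \<rightarrow>\<^sub>E E| \<le>o |UNIV :: nat set set|"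
proof -
  obtain g :: "_ \<Rightarrow> nat set" where g: "inj_on g E"
    using assms(2) card_of_ordLeq[of E "UNIV :: nat set set"] by blast
  \<comment> \<open>A sequence becomes a single set of naturals: a pair records the number of an
    index in the enumeration of \<open>A\<close> and one element of the real \<open>g (a x)\<close>
    that encodes the entry there. Every \<open>g (a x)\<close> can be read off from the
    code.\<close>
  define code where "code a =
    prod_encode ` {(n, m). n \<in> to_nat_on A ` A \<and> m \<in> g (a (from_nat_into A n))}"
    for a
  have mem: "m \<in> g (a x) \<longleftrightarrow> prod_encode (to_nat_on A x, m) \<in> code a" if "x \<in> A" for a x m
    using that assms(1) unfolding code_def
    by (auto simp: inj_image_mem_iff[OF inj_prod_encode])
  have "inj_on code (A \<rightarrow>\<^sub>E E)"
  proof (rule inj_onI)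
    fix a b assume ab: "a \<in> A \<rightarrow>\<^sub>E E" "b \<in> A \<rightarrow>\<^sub>E E" and eq: "code a = code b"
    show "a = b"
    proof (rule PiE_ext[OF ab])
      fix x assume x: "x \<in> A"
      have "g (a x) = g (b x)"
        using mem[OF x] eq by blast
      moreover have "a x \<in> E" "b x \<in> E"
        using ab x by auto
      ultimately show "a x = b x"
        using g by (meson inj_onD)
    qed
  qed
  then show ?thesis
    by (rule card_of_ordLeqI) simp
qed

text \<open>By Cantor the continuum is a cardinal above \<open>natLeq\<close>, hence at least the
  successor \<open>omega1\<close>. A proper initial segment of a cardinal is strictly smaller than
  it, and below a successor this means countable.\<close>

lemma omega1_props:
  shows "Well_order omega1"
    and "|Field omega1| \<le>o |UNIV :: nat set set|"
    and "\<alpha> \<in> Field omega1 \<Longrightarrow> countable (underS omega1 \<alpha>)"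
proof -
  have co: "Card_order omega1"
    by (rule cardSuc_Card_order[OF natLeq_Card_order])
  then show "Well_order omega1"
    by (simp add: card_order_on_def)
  have "natLeq =o |UNIV :: nat set|"
    using card_of_nat ordIso_symmetric by blast
  then have "natLeq <o |UNIV :: nat set set|"
    using card_of_Pow[of "UNIV :: nat set"] ordIso_ordLess_trans by (metis Pow_UNIV)
  then have "omega1 \<le>o |UNIV :: nat set set|"
    by (intro cardSuc_least natLeq_Card_order card_of_Card_order)
  moreover have "|Field omega1| =o omega1"
    using card_of_Field_ordIso co by blast
  ultimately show "|Field omega1| \<le>o |UNIV :: nat set set|"
    using ordIso_ordLeq_trans by blast
  show "countable (underS omega1 \<alpha>)" if "\<alpha> \<in> Field omega1"
  proof -
    have "|underS omega1 \<alpha>| <o omega1"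
      using card_of_underS[OF co that] .
    then have "|underS omega1 \<alpha>| \<le>o natLeq"
      using cardSuc_ordLeq_ordLess[OF natLeq_Card_order card_of_Card_order] by blast
    then show ?thesis
      by (meson card_of_nat card_of_ordLeq countableI ordIso_symmetric ordLeq_ordIso_trans)
  qed
qed

section \<open>Sequences built by recursion from parameters\<close>

text \<open>Think of \<open>F \<beta> g x\<close> as the move of Alice at inning \<beta> chosen to
  force the answer \<open>x\<close> after the history \<open>g\<close>. The members are then the
  histories before \<alpha> that use chosen moves only. Extensionality makes a history determined by
  its entries.\<close>

definition param_seqs ::
    "'i rel \<Rightarrow> ('i \<Rightarrow> ('i \<Rightarrow> 'b) \<Rightarrow> 'a \<Rightarrow> 'b) \<Rightarrow> 'a set \<Rightarrow> 'i \<Rightarrow> ('i \<Rightarrow> 'b) set" where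
  "param_seqs r F E \<alpha> =
     {h \<in> extensional (underS r \<alpha>).
        \<forall>\<beta>\<in>underS r \<alpha>. \<exists>x\<in>E. h \<beta> = F \<beta> (restrict h (underS r \<beta>)) x}"

lemma underS_subset_underS:
  assumes "Well_order r" and "\<beta> \<in> underS r \<alpha>"
  shows "underS r \<beta> \<subseteq> underS r \<alpha>"
proof -
  have "trans r" "antisym r"
    using assms(1)
    unfolding well_order_on_def linear_order_on_def partial_order_on_def preorder_on_def by auto
  then show ?thesis
    using assms(2) by (auto simp: underS_def dest: transD antisymD)
qed

text \<open>Along a well-order, the parameters determine the sequence: each entry is computed from
  the earlier entries and its own parameter. Sending a sequence to one choice of its parameters is
  therefore injective, and there are at most continuum many countable sequences in
  \<open>E\<close>.\<close>

lemma card_of_param_seqs: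
  assumes "Well_order r" and "countable (underS r \<alpha>)" and "|E| \<le>o |UNIV :: nat set set|"
  shows "|param_seqs r F E \<alpha>| \<le>o |UNIV :: nat set set|"
proof -
  define par where "par h =
    (\<lambda>\<beta>\<in>underS r \<alpha>. SOME x. x \<in> E \<and> h \<beta> = F \<beta> (restrict h (underS r \<beta>)) x)" for h
  have par: "par h \<beta> \<in> E" "h \<beta> = F \<beta> (restrict h (underS r \<beta>)) (par h \<beta>)"
    if "h \<in> param_seqs r F E \<alpha>" "\<beta> \<in> underS r \<alpha>" for h \<beta>
  proof -
    have "\<exists>x. x \<in> E \<and> h \<beta> = F \<beta> (restrict h (underS r \<beta>)) x"
      using that unfolding param_seqs_def by blast
    from someI_ex[OF this] that(2)
    show "par h \<beta> \<in> E" "h \<beta> = F \<beta> (restrict h (underS r \<beta>)) (par h \<beta>)"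
      unfolding par_def by auto
  qed
  have "inj_on par (param_seqs r F E \<alpha>)"
  proof (rule inj_onI)
    fix h k assume h: "h \<in> param_seqs r F E \<alpha>" and k: "k \<in> param_seqs r F E \<alpha>"
      and eq: "par h = par k"
    have "wf (r - Id)"
      using assms(1) by (simp add: well_order_on_def)
    then have "\<beta> \<in> underS r \<alpha> \<longrightarrow> h \<beta> = k \<beta>" for \<beta>
    proof (induction \<beta> rule: wf_induct_rule)
      case (less \<beta>)
      show ?case
      proof
        assume \<beta>: "\<beta> \<in> underS r \<alpha>"
        have "restrict h (underS r \<beta>) = restrict k (underS r \<beta>)"
        proof (rule restrict_ext)
          fix \<gamma> assume \<gamma>: "\<gamma> \<in> underS r \<beta>"
          then have "(\<gamma>, \<beta>) \<in> r - Id"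
            by (auto simp: underS_def)
          moreover have "\<gamma> \<in> underS r \<alpha>"
            using underS_subset_underS[OF assms(1) \<beta>] \<gamma> by blast
          ultimately show "h \<gamma> = k \<gamma>"
            using less by blast
        qed
        then show "h \<beta> = k \<beta>"
          using par(2)[OF h \<beta>] par(2)[OF k \<beta>] eq by metis
      qed
    qed
    then show "h = k"
      using h k unfolding param_seqs_def
      by (intro extensionalityI[of h "underS r \<alpha>" k]) auto
  qed
  moreover have "par h \<in> underS r \<alpha> \<rightarrow>\<^sub>E E" if "h \<in> param_seqs r F E \<alpha>" for h
    using par(1)[OF that] by (auto simp: par_def)
  ultimately have "|param_seqs r F E \<alpha>| \<le>o |underS r \<alpha> \<rightarrow>\<^sub>E E|"
    by (rule card_of_ordLeqI)
  then show ?thesis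
    using card_of_PiE_countable_le_continuum[OF assms(2,3)] ordLeq_transitive by blast
qed

section \<open>Forcing the answers of Bob\<close>

lemma under_eq_insert_underS:
  assumes "Well_order r" and "\<alpha> \<in> Field r"
  shows "under r \<alpha> = insert \<alpha> (underS r \<alpha>)"
proof -
  have "refl_on (Field r) r"
    using assms(1)
    unfolding well_order_on_def linear_order_on_def partial_order_on_def preorder_on_def by auto
  then show ?thesis
    using assms(2) by (auto simp: under_def underS_def dest: refl_onD)
qed

text \<open>If \<open>p\<close> were in the closure of the set \<open>B\<close> of points that are
  never answered after \<open>h\<close>, then \<open>B\<close> would be a legal move, and the answer
  to it would be a point of \<open>B\<close> that is answered. So the complement of the closure of
  \<open>B\<close> is the required neighbourhood.\<close>

lemma forced_answers_nhd:
  assumes \<sigma>: "bob_strategy X p \<sigma>" and p: "p \<in> topspace X"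
    and \<alpha>: "\<alpha> \<in> Field omega1"
    and h: "h \<in> underS omega1 \<alpha> \<rightarrow>\<^sub>E Omega_at X p"
  shows "\<exists>U. openin X U \<and> p \<in> U \<and> (\<forall>x\<in>U. \<exists>A\<in>Omega_at X p. \<sigma> \<alpha> (h(\<alpha> := A)) = x)"
proof -
  define B where "B = {x \<in> topspace X. \<forall>A\<in>Omega_at X p. \<sigma> \<alpha> (h(\<alpha> := A)) \<noteq> x}"
  have "B \<notin> Omega_at X p"
  proof
    assume B: "B \<in> Omega_at X p"
    have "h(\<alpha> := B) \<in> under omega1 \<alpha> \<rightarrow>\<^sub>E Omega_at X p"
      unfolding under_eq_insert_underS[OF omega1_props(1) \<alpha>]
      using PiE_fun_upd[OF B h] .
    then have "\<sigma> \<alpha> (h(\<alpha> := B)) \<in> (h(\<alpha> := B)) \<alpha>"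
      using \<sigma> \<alpha> unfolding bob_strategy_def by blast
    then show False
      using B unfolding B_def by auto
  qed
  moreover have sub: "B \<subseteq> topspace X"
    unfolding B_def by blast
  ultimately have "p \<notin> X closure_of B"
    unfolding Omega_at_def by blast
  moreover have "B \<subseteq> X closure_of B"
    using sub by (rule closure_of_subset)
  moreover have "openin X (topspace X - X closure_of B)"
    by (simp add: openin_diff)
  ultimately show ?thesis
    using p by (intro exI[of _ "topspace X - X closure_of B"]) (auto simp: B_def)
qed

lemma trace_of_forced_nhd_subset:
  fixes X :: "'a topology" and p :: 'a and \<sigma> :: "nat set \<Rightarrow> (nat set \<Rightarrow> 'a set) \<Rightarrow> 'a"
    and U :: "nat set \<Rightarrow> (nat set \<Rightarrow> 'a set) \<Rightarrow> 'a set"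
  defines "F \<equiv> \<lambda>\<alpha> h x. SOME A. A \<in> Omega_at X p \<and> \<sigma> \<alpha> (h(\<alpha> := A)) = x"
  assumes win: "bob_winning_strategy X p \<sigma>"
    and U: "\<And>\<alpha> h x. \<lbrakk>\<alpha> \<in> Field omega1; h \<in> underS omega1 \<alpha> \<rightarrow>\<^sub>E Omega_at X p; x \<in> U \<alpha> h\<rbrakk>
      \<Longrightarrow> \<exists>A\<in>Omega_at X p. \<sigma> \<alpha> (h(\<alpha> := A)) = x"
    and V: "openin X V" "p \<in> V"
  shows "\<exists>\<alpha>\<in>Field omega1. \<exists>h\<in>param_seqs omega1 F E \<alpha> \<inter> (underS omega1 \<alpha> \<rightarrow>\<^sub>E Omega_at X p).
           U \<alpha> h \<inter> E \<subseteq> V"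
proof (rule ccontr)
  let ?r = "omega1" and ?\<Omega> = "Omega_at X p"
  let ?H = "\<lambda>\<alpha>. param_seqs ?r F E \<alpha> \<inter> (underS ?r \<alpha> \<rightarrow>\<^sub>E ?\<Omega>)"
  assume contra: "\<not> ?thesis"
  define pick where "pick \<alpha> h = (SOME x. x \<in> U \<alpha> h \<inter> E - V)" for \<alpha> h
  have pick: "pick \<alpha> h \<in> U \<alpha> h \<inter> E - V" if "\<alpha> \<in> Field ?r" "h \<in> ?H \<alpha>" for \<alpha> h
  proof -
    have "\<exists>x. x \<in> U \<alpha> h \<inter> E - V"
      using contra that by blast
    then show ?thesis
      unfolding pick_def by (rule someI_ex)
  qed
  have F: "F \<alpha> h (pick \<alpha> h) \<in> ?\<Omega>" "\<sigma> \<alpha> (h(\<alpha> := F \<alpha> h (pick \<alpha> h))) = pick \<alpha> h"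
    if "\<alpha> \<in> Field ?r" "h \<in> ?H \<alpha>" for \<alpha> h
  proof -
    have "\<exists>A. A \<in> ?\<Omega> \<and> \<sigma> \<alpha> (h(\<alpha> := A)) = pick \<alpha> h"
      using U[of \<alpha> h "pick \<alpha> h"] pick[OF that] that by blast
    from someI_ex[OF this]
    show "F \<alpha> h (pick \<alpha> h) \<in> ?\<Omega>" "\<sigma> \<alpha> (h(\<alpha> := F \<alpha> h (pick \<alpha> h))) = pick \<alpha> h"
      unfolding F_def by auto
  qed
  have wf: "wf (?r - Id)"
    using omega1_props(1) by (simp add: well_order_on_def)
  \<comment> \<open>The play of Alice: at each inning, the chosen move that forces
    \<open>pick\<close> after her own earlier moves. Only values strictly below \<alpha> are read,
    so the recursion equation holds without the cut.\<close>
  define A where "A = wfrec (?r - Id)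
    (\<lambda>f \<alpha>. F \<alpha> (restrict f (underS ?r \<alpha>)) (pick \<alpha> (restrict f (underS ?r \<alpha>))))"
  have A: "A \<alpha> = F \<alpha> (restrict A (underS ?r \<alpha>)) (pick \<alpha> (restrict A (underS ?r \<alpha>)))" for \<alpha>
  proof -
    have "restrict (cut A (?r - Id) \<alpha>) (underS ?r \<alpha>) = restrict A (underS ?r \<alpha>)"
      by (rule restrict_ext) (auto simp: cut_def underS_def)
    then show ?thesis
      unfolding A_def by (subst wfrec[OF wf]) simp
  qed
  \<comment> \<open>The properties of \<open>pick\<close> and \<open>F\<close> are known on
    \<open>?H\<close> only, so the histories of this play must be shown to stay there. Cutting the
    history before \<alpha> down to an earlier \<beta> gives the history before \<beta>, by
    transitivity.\<close>
  have hist: "\<alpha> \<in> Field ?r \<longrightarrow> restrict A (underS ?r \<alpha>) \<in> ?H \<alpha>" for \<alpha>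
    using wf
  proof (induction \<alpha> rule: wf_induct_rule)
    case (less \<alpha>)
    have earlier: "A \<beta> \<in> ?\<Omega>"
      "\<exists>x\<in>E. A \<beta> = F \<beta> (restrict (restrict A (underS ?r \<alpha>)) (underS ?r \<beta>)) x"
      if \<beta>: "\<beta> \<in> underS ?r \<alpha>" for \<beta>
    proof -
      have "(\<beta>, \<alpha>) \<in> ?r - Id" and field: "\<beta> \<in> Field ?r"
        using \<beta> by (auto simp: underS_def Field_def)
      then have IH: "restrict A (underS ?r \<beta>) \<in> ?H \<beta>"
        using less by blast
      show "A \<beta> \<in> ?\<Omega>"
        using F(1)[OF field IH] A[of \<beta>] by simp
      have "underS ?r \<alpha> \<inter> underS ?r \<beta> = underS ?r \<beta>"
        using underS_subset_underS[OF omega1_props(1) \<beta>] by blast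
      then show "\<exists>x\<in>E. A \<beta> = F \<beta> (restrict (restrict A (underS ?r \<alpha>)) (underS ?r \<beta>)) x"
        using pick[OF field IH] A[of \<beta>] by (auto simp: restrict_restrict)
    qed
    have "restrict A (underS ?r \<alpha>) \<in> param_seqs ?r F E \<alpha>"
      unfolding param_seqs_def using earlier(2)
      by (intro CollectI conjI ballI restrict_extensional) (simp only: restrict_apply' restrict_extensional)+
    moreover have "restrict A (underS ?r \<alpha>) \<in> underS ?r \<alpha> \<rightarrow>\<^sub>E ?\<Omega>"
      using earlier(1) by (auto simp only: restrict_PiE_iff)
    ultimately show ?case
      by blast
  qed
  have A_mem: "A \<in> Field ?r \<rightarrow> ?\<Omega>"
    using F(1) hist A by (metis Pi_I)
  have "\<sigma> \<alpha> (restrict A (under ?r \<alpha>)) \<in> topspace X - V" if \<alpha>: "\<alpha> \<in> Field ?r" for \<alpha>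
  proof -
    let ?h = "restrict A (underS ?r \<alpha>)"
    have h: "?h \<in> ?H \<alpha>"
      using hist \<alpha> by blast
    \<comment> \<open>The strategy sees the moves up to and including \<alpha>, whereas histories
      stop before \<alpha>; the update supplies the current move.\<close>
    have upd: "restrict A (under ?r \<alpha>) = ?h(\<alpha> := A \<alpha>)"
      unfolding under_eq_insert_underS[OF omega1_props(1) \<alpha>] by (auto simp: fun_eq_iff)
    then have "\<sigma> \<alpha> (restrict A (under ?r \<alpha>)) = pick \<alpha> ?h"
      using F(2)[OF \<alpha> h] A[of \<alpha>] by metis
    moreover have "restrict A (under ?r \<alpha>) \<in> under ?r \<alpha> \<rightarrow>\<^sub>E ?\<Omega>"
      using A_mem by (auto simp: under_def Field_def)
    then have "\<sigma> \<alpha> (restrict A (under ?r \<alpha>)) \<in> restrict A (under ?r \<alpha>) \<alpha>"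
      using win \<alpha> unfolding bob_winning_strategy_def bob_strategy_def by blast
    then have "\<sigma> \<alpha> (restrict A (under ?r \<alpha>)) \<in> A \<alpha>"
      by (simp add: upd)
    moreover have "A \<alpha> \<subseteq> topspace X"
      using A_mem \<alpha> unfolding Omega_at_def by auto
    ultimately show ?thesis
      using pick[OF \<alpha> h] by auto
  qed
  then have "(\<lambda>\<alpha>. \<sigma> \<alpha> (restrict A (under ?r \<alpha>))) ` Field ?r \<inter> V = {}"
    by auto
  moreover have "p \<in> X closure_of ((\<lambda>\<alpha>. \<sigma> \<alpha> (restrict A (under ?r \<alpha>))) ` Field ?r)"
    using win A_mem unfolding bob_winning_strategy_def bob_wins_def Omega_at_def by blast
  ultimately show False
    using V unfolding in_closure_of by blast
qed

theorem theorem9: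
  fixes X :: "'a topology" and E :: "'a set" and p :: 'a
  assumes "regular_space X" and "t1_space X"
    and "E \<subseteq> topspace X" and "X closure_of E = topspace X"
    and "|E| \<le>o |UNIV :: nat set set|"
    and "p \<in> topspace X"
    and "\<exists>\<sigma>. bob_winning_strategy X p \<sigma>"
  shows "character X p \<le>o |UNIV :: nat set set|"
proof -
  obtain \<sigma> where win: "bob_winning_strategy X p \<sigma>"
    using assms(7) by blast
  then have strat: "bob_strategy X p \<sigma>"
    unfolding bob_winning_strategy_def by blast
  let ?\<Omega> = "Omega_at X p" and ?c = "|UNIV :: nat set set|"
  define F where "F = (\<lambda>\<alpha> h x. SOME A. A \<in> ?\<Omega> \<and> \<sigma> \<alpha> (h(\<alpha> := A)) = x)"
  define H where "H \<alpha> = param_seqs omega1 F E \<alpha> \<inter> (underS omega1 \<alpha> \<rightarrow>\<^sub>E ?\<Omega>)" for \<alpha>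
  \<comment> \<open>One neighbourhood is fixed for each history, so that counting histories bounds
    the number of neighbourhoods.\<close>
  define U where "U \<alpha> h = (SOME U. openin X U \<and> p \<in> U \<and>
    (\<forall>x\<in>U. \<exists>A\<in>?\<Omega>. \<sigma> \<alpha> (h(\<alpha> := A)) = x))" for \<alpha> h
  have U: "openin X (U \<alpha> h) \<and> p \<in> U \<alpha> h \<and> (\<forall>x\<in>U \<alpha> h. \<exists>A\<in>?\<Omega>. \<sigma> \<alpha> (h(\<alpha> := A)) = x)"
    if "\<alpha> \<in> Field omega1" "h \<in> underS omega1 \<alpha> \<rightarrow>\<^sub>E ?\<Omega>" for \<alpha> h
    unfolding U_def by (rule someI_ex[OF forced_answers_nhd[OF strat assms(6) that]])
  define \<B> where "\<B> = (\<Union>\<alpha>\<in>Field omega1. U \<alpha> ` H \<alpha>)"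
  have "local_base X p \<B>"
    unfolding local_base_def
  proof (intro conjI ballI allI impI)
    fix N assume "N \<in> \<B>"
    then show "openin X N" "p \<in> N"
      using U unfolding \<B>_def H_def by auto
  next
    fix W assume "openin X W \<and> p \<in> W"
    \<comment> \<open>Regularity places a closed set between \<open>V\<close> and \<open>W\<close>:
      the trace on \<open>E\<close> will be found inside \<open>V\<close>, while the whole
      neighbourhood is only controlled up to closure.\<close>
    then obtain V C where V: "openin X V" "p \<in> V" and C: "closedin X C" "V \<subseteq> C" "C \<subseteq> W"
      using assms(1) unfolding neighbourhood_base_of_closedin[symmetric] neighbourhood_base_of
      by meson
    have "\<exists>\<alpha>\<in>Field omega1. \<exists>h\<in>H \<alpha>. U \<alpha> h \<inter> E \<subseteq> V"
      unfolding H_def F_def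
      by (rule trace_of_forced_nhd_subset[OF win _ V]) (use U in blast)
    then obtain \<alpha> h where \<alpha>: "\<alpha> \<in> Field omega1" and h: "h \<in> H \<alpha>" and sub: "U \<alpha> h \<inter> E \<subseteq> V"
      by blast
    have op: "openin X (U \<alpha> h)"
      using U[OF \<alpha>] h unfolding H_def by blast
    \<comment> \<open>Since \<open>E\<close> is dense, an open set lies in the closure of its trace
      on \<open>E\<close>.\<close>
    then have "U \<alpha> h \<subseteq> X closure_of (U \<alpha> h \<inter> X closure_of E)"
      using assms(4) by (simp add: closure_of_subset openin_subset inf.absorb1)
    also have "\<dots> = X closure_of (U \<alpha> h \<inter> E)"
      using op by (rule closure_of_openin_Int_closure_of)
    also have "\<dots> \<subseteq> C"
      using sub C by (intro closure_of_minimal) auto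
    finally have "U \<alpha> h \<subseteq> W"
      using C by blast
    then show "\<exists>N\<in>\<B>. N \<subseteq> W"
      using \<alpha> h unfolding \<B>_def by blast
  qed
  moreover have "|\<B>| \<le>o ?c"
    unfolding \<B>_def
  proof (rule card_of_UNION_ordLeq_infinite)
    show "infinite (UNIV :: nat set set)"
      by (simp add: Finite_Set.finite_set)
    show "|Field omega1| \<le>o ?c"
      by (rule omega1_props(2))
    show "\<forall>\<alpha>\<in>Field omega1. |U \<alpha> ` H \<alpha>| \<le>o ?c"
    proof
      fix \<alpha> assume \<alpha>: "\<alpha> \<in> Field omega1"
      have "|U \<alpha> ` H \<alpha>| \<le>o |H \<alpha>|"
        by (rule card_of_image)
      also have "|H \<alpha>| \<le>o |param_seqs omega1 F E \<alpha>|"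
        unfolding H_def by (rule card_of_mono1) blast
      also have "|param_seqs omega1 F E \<alpha>| \<le>o ?c"
        by (rule card_of_param_seqs[OF omega1_props(1) omega1_props(3)[OF \<alpha>] assms(5)])
      finally show "|U \<alpha> ` H \<alpha>| \<le>o ?c" .
    qed
  qed
  moreover have "Cinfinite ?c"
    unfolding cinfinite_def Field_card_of
    using card_of_card_order_on by (simp add: Finite_Set.finite_set)
  ultimately have "character_bound X p ?c"
    by (intro character_boundI)
  then show ?thesis
    using character_least[OF assms(6)] by blast
qed

end
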